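(* Let $\overline{E} = (E, \|\cdot\|)$ be a Euclidean lattice of rank $n\ge 1$, and suppose that $E$ admits a $\mathbb{Z}$-basis which is orthogonal with respect to the scalar product of $\overline{E}$. Then $$-\frac{1}{2}n \log n+\log\left(1-\tfrac{1}{2\pi}\right)\;\leq\; \widehat h^0(\overline E)+\sum_{i=1}^n \log\min(\lambda_i(\overline E),1)\;\leq\; \pi+ n\log \frac{3}{2}.$$
   Context: A Euclidean lattice $\overline{E}=(E,\|\cdot\|)$ of rank $n$ consists of an $n$-dimensional real vector space $E_{\mathbb R}$, a lattice $E=\bigoplus_{i=1}^n\mathbb{Z}e_i\subset E_{\mathbb R}$ where $\{e_1,\dots,e_n\}$ is an $\mathbb{R}$-basis of $E_{\mathbb R}$, and a norm $\|\cdot\|$ on $E_{\mathbb R}$ associated with a Euclidean scalar product. $\widehat{h}^0(\overline{E})=\log\#\{m\in E\mid \|m\|\le 1\}$. For $i=1,\dots,n$, the $i$-th successive minimum $\lambda_i(\overline{E})$ is the infimum of all $r>0$ such that the real span of $E\cap\{m\in E_{\mathbb R}\mid \|m\|\le r\}$ has dimension at least $i$. *)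

theory Defs
  imports "HOL-Analysis.Analysis"
begin

definition int_scale :: "int \<Rightarrow> 'a::real_vector \<Rightarrow> 'a" where
  "int_scale k x = of_int k *\<^sub>R x"

text \<open>The library's module locale, at the ring of integers, provides \<open>\<int>\<close>-spans
  (\<open>int_mod.span\<close>) and \<open>\<int>\<close>-linear independence (\<open>int_mod.independent\<close>).\<close>

interpretation int_mod: module "int_scale :: int \<Rightarrow> 'a::real_vector \<Rightarrow> 'a"
  by unfold_locales (simp_all add: int_scale_def algebra_simps)

definition int_basis :: "'a::real_vector set \<Rightarrow> 'a set \<Rightarrow> bool" where
  "int_basis B E \<longleftrightarrow> int_mod.independent B \<and> int_mod.span B = E"

text \<open>The scalar product and norm of a Euclidean lattice are those of the ambient type, and
  its rank is \<open>DIM('a)\<close>.  In the next definition \<open>independent\<close> and \<open>span\<close> are over the reals: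
  a \<open>\<int>\<close>-linearly independent set need not be \<open>\<real>\<close>-linearly independent.\<close>

definition euclidean_lattice :: "'a::euclidean_space set \<Rightarrow> bool" where
  "euclidean_lattice E \<longleftrightarrow>
     (\<exists>B. independent B \<and> span B = UNIV \<and> E = int_mod.span B)"

text \<open>A lattice is discrete, so for a lattice the set counted below is finite; it contains 0.\<close>

definition h0_hat :: "'a::euclidean_space set \<Rightarrow> real" where
  "h0_hat E = ln (real (card {m \<in> E. norm m \<le> 1}))"

text \<open>For a lattice and \<open>1 \<le> i \<le> DIM('a)\<close> the set below is nonempty, so that \<open>Inf\<close> is its infimum.\<close>

definition successive_minimum :: "'a::euclidean_space set \<Rightarrow> nat \<Rightarrow> real" where
  "successive_minimum E i =
     Inf {r. r > 0 \<and> i \<le> dim (span (E \<inter> {m. norm m \<le> r}))}"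

end

theory Submission
  imports Defs "HOL-Probability.Distributions"
begin

text \<open>
  For an orthogonal basis \<open>B\<close> the successive minima are the norms of the basis vectors in
  increasing order, so the quantity in question is the logarithm of
  \<open>N \<cdot> (\<Prod>b\<in>B. min (norm b) 1)\<close>, where \<open>N\<close> counts the integer points of the ellipsoid
  \<open>(\<Sum>b\<in>B. (k b * norm b)\<^sup>2) \<le> 1\<close>.  The box \<open>\<bar>k b\<bar> \<le> 1 / (norm b * sqrt n)\<close> inscribed in the
  ellipsoid gives \<open>n powr (- n / 2)\<close> as a lower bound.  For the upper bound each point is weighted by
  \<open>exp (pi * (1 - (\<Sum>b\<in>B. (k b * norm b)\<^sup>2)))\<close>, which is at least 1 on the ellipsoid; over the
  circumscribed box the sum of the weights factors into one-dimensional theta sums, each at most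
  \<open>(3/2) / min (norm b) 1\<close>.
\<close>

section \<open>One-dimensional estimates: theta sums and integers in an interval\<close>

lemma sum_int_symmetric:
  fixes f :: "int \<Rightarrow> real"
  assumes "\<And>j. f (- j) = f j"
  shows "(\<Sum>j\<in>{- int N..int N}. f j) = f 0 + 2 * (\<Sum>k=1..N. f (int k))"
proof (induction N)
  case 0
  then show ?case by simp
next
  case (Suc N)
  have "{- int (Suc N)..int (Suc N)} = insert (- int (Suc N)) (insert (int (Suc N)) {- int N..int N})"
    by auto
  then show ?case
    using Suc assms[of "int (Suc N)"] by (simp del: of_nat_Suc)
qed

text \<open>A right-endpoint Riemann sum of a function decreasing on the half-line lies below its
  integral over \<open>{0..K * h}\<close>, which the half-line Gaussian integral bounds uniformly in
  \<open>K\<close>.\<close>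

lemma gaussian_riemann_sum_le:
  fixes h :: real
  assumes "h > 0"
  shows "(\<Sum>k=1..K. h * exp (- (real k * h)\<^sup>2)) \<le> sqrt pi / 2"
proof -
  let ?g = "\<lambda>x::real. exp (- x\<^sup>2)"
  have g_int: "?g integrable_on {a..b}" for a b
    by (intro integrable_continuous_interval continuous_intros)
  have "(\<Sum>k=1..K. h * ?g (real k * h)) \<le> integral {0..real K * h} ?g" for K
  proof (induction K)
    case 0
    then show ?case by simp
  next
    case (Suc K)
    have le: "real K * h \<le> real (Suc K) * h"
      using assms by simp
    have "h * ?g (real (Suc K) * h) = integral {real K * h..real (Suc K) * h} (\<lambda>x. ?g (real (Suc K) * h))"
      using le by (simp add: algebra_simps)
    also have "\<dots> \<le> integral {real K * h..real (Suc K) * h} ?g"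
    proof (intro integral_le g_int integrable_const_ivl)
      fix x assume x: "x \<in> {real K * h..real (Suc K) * h}"
      moreover have "0 \<le> real K * h"
        using assms by simp
      ultimately show "?g (real (Suc K) * h) \<le> ?g x"
        by (intro exp_le_cancel_iff[THEN iffD2] le_imp_neg_le power_mono) auto
    qed
    finally have "h * ?g (real (Suc K) * h) \<le> integral {real K * h..real (Suc K) * h} ?g" .
    moreover have "integral {0..real K * h} ?g + integral {real K * h..real (Suc K) * h} ?g
        = integral {0..real (Suc K) * h} ?g"
      using assms le by (intro Henstock_Kurzweil_Integration.integral_combine g_int) auto
    ultimately show ?case
      using Suc by simp
  qed
  also have "integral {0..real K * h} ?g \<le> sqrt pi / 2"
  proof -
    \<comment> \<open>The known Lebesgue integral is turned into a gauge integral over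
      \<open>{0..}\<close>, so that it can be compared with the one over a bounded interval.\<close>
    have "((\<lambda>x. indicator {0..} x *\<^sub>R ?g x) has_integral sqrt pi / 2) UNIV"
      using gaussian_moment_0 has_integral_integral_lborel
      by (metis has_bochner_integral_iff)
    moreover have "(\<lambda>x. indicator {0..} x *\<^sub>R ?g x) = (\<lambda>x. if x \<in> {0..} then ?g x else 0)"
      by (auto simp: indicator_def)
    ultimately have hi: "(?g has_integral sqrt pi / 2) {0..}"
      by (simp only: has_integral_restrict_UNIV)
    show ?thesis
      using has_integral_subset_le[OF _ integrable_integral[OF g_int] hi] by auto
  qed
  finally show ?thesis .
qed

text \<open>Since \<open>k\<^sup>2\<close> is at least \<open>1 + 3 * (k - 1)\<close>, with equality
  for \<open>k = 1\<close> and \<open>k = 2\<close>, a geometric series of ratio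
  \<open>q ^ 3\<close> dominates and keeps the two leading terms exact.\<close>

lemma sum_power_squares_le:
  fixes q :: real
  assumes "0 \<le> q" "q < 1"
  shows "(\<Sum>k=1..K. q ^ (k\<^sup>2)) \<le> q / (1 - q ^ 3)"
proof -
  have q3: "q ^ 3 < 1"
    using assms power_strict_mono[of q 1 3] by simp
  have "(\<Sum>k=1..K. q ^ (k\<^sup>2)) \<le> (\<Sum>k=1..K. q * (q ^ 3) ^ (k - 1))"
  proof (intro sum_mono)
    fix k assume "k \<in> {1..K}"
    then obtain l where "k = Suc l"
      by (cases k) auto
    moreover have "Suc (3 * l) \<le> (Suc l)\<^sup>2"
      by (cases l) (auto simp: power2_eq_square)
    then have "q ^ ((Suc l)\<^sup>2) \<le> q ^ Suc (3 * l)"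
      using assms by (intro power_decreasing) auto
    ultimately show "q ^ (k\<^sup>2) \<le> q * (q ^ 3) ^ (k - 1)"
      by (simp add: power_mult)
  qed
  also have "\<dots> = q * (\<Sum>l<K. (q ^ 3) ^ l)"
    by (simp add: sum_distrib_left sum.atLeast1_atMost_eq)
  also have "\<dots> \<le> q * (\<Sum>l. (q ^ 3) ^ l)"
    using assms q3 by (intro mult_left_mono sum_le_suminf summable_geometric) auto
  also have "\<dots> = q / (1 - q ^ 3)"
    using assms q3 by (subst suminf_geometric) auto
  finally show ?thesis .
qed

text \<open>Cutting the exponential series after the cubic term gives a rational bound for rational
  \<open>y\<close>, so numerical estimates reduce to arithmetic.\<close>

lemma exp_minus_le_cubic:
  fixes y :: real
  assumes "0 \<le> y"
  shows "exp (- y) \<le> 1 / (1 + y + y\<^sup>2 / 2 + y ^ 3 / 6)"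
proof -
  have "(\<Sum>k<4. y ^ k /\<^sub>R fact k) \<le> exp y"
    unfolding exp_def using assms summable_exp_generic[of y]
    by (intro sum_le_suminf) auto
  then have "1 + y + y\<^sup>2 / 2 + y ^ 3 / 6 \<le> exp y"
    by (simp add: eval_nat_numeral field_simps)
  moreover have "0 < 1 + y + y\<^sup>2 / 2 + y ^ 3 / 6"
    using assms by (simp add: add_pos_nonneg)
  ultimately show ?thesis
    by (simp add: exp_minus divide_simps)
qed

text \<open>The factor 3/2 is not sharp.  Comparison with the Gaussian integral gives only
  \<open>1 + a\<close>, so \<open>a > 1/2\<close> needs a geometric series instead, on two ranges of \<open>a\<close>.\<close>

lemma scaled_theta_sum_le:
  fixes a :: real
  assumes a: "0 < a" "a \<le> 1"
  shows "a * (1 + 2 * (\<Sum>k=1..K. exp (- (pi * (real k * a)\<^sup>2)))) \<le> 3 / 2"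
proof -
  \<comment> \<open>On \<open>u \<le> a \<le> v\<close>, the bound pi > 3 gives
    \<open>y \<le> 3 * u\<^sup>2 \<le> pi * a\<^sup>2\<close>, so \<open>q\<close> dominates
    \<open>exp (- (pi * a\<^sup>2))\<close>, while \<open>v\<close> dominates the outer factor. For
    numerals all side conditions are rational.\<close>
  have geometric: ?thesis
    if "u \<le> a" "a \<le> v" "0 \<le> y" "y \<le> 3 * u\<^sup>2" "0 \<le> u"
      and q: "1 / (1 + y + y\<^sup>2 / 2 + y ^ 3 / 6) \<le> q" "q < 1"
      and "v * (1 + 2 * (q / (1 - q ^ 3))) \<le> 3 / 2" for u v y q :: real
  proof -
    have "0 < 1 + y + y\<^sup>2 / 2 + y ^ 3 / 6"
      using that by (simp add: add_pos_nonneg)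
    then have q0: "0 \<le> q"
      using q by (meson divide_nonneg_pos order_trans zero_le_one)
    have "y \<le> pi * a\<^sup>2"
    proof -
      have "3 * u\<^sup>2 \<le> pi * a\<^sup>2"
        using that pi_gt3 by (intro mult_mono power_mono) auto
      then show ?thesis
        using that by simp
    qed
    then have "exp (- (pi * a\<^sup>2)) \<le> q"
      using exp_minus_le_cubic[OF \<open>0 \<le> y\<close>] q
      by (smt (verit) exp_le_cancel_iff)
    then have "exp (- (pi * (real k * a)\<^sup>2)) \<le> q ^ (k\<^sup>2)" for k
    proof -
      have "exp (- (pi * (real k * a)\<^sup>2)) = exp (- (pi * a\<^sup>2)) ^ (k\<^sup>2)"
        by (simp add: exp_of_nat_mult[symmetric] algebra_simps)
      then show ?thesis
        using \<open>exp (- (pi * a\<^sup>2)) \<le> q\<close> by (simp add: power_mono)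
    qed
    then have "(\<Sum>k=1..K. exp (- (pi * (real k * a)\<^sup>2))) \<le> (\<Sum>k=1..K. q ^ (k\<^sup>2))"
      by (intro sum_mono) auto
    also have "\<dots> \<le> q / (1 - q ^ 3)"
      by (rule sum_power_squares_le[OF q0 q(2)])
    finally have "a * (1 + 2 * (\<Sum>k=1..K. exp (- (pi * (real k * a)\<^sup>2)))) \<le> v * (1 + 2 * (q / (1 - q ^ 3)))"
      using that a by (intro mult_mono) (auto intro!: add_nonneg_nonneg sum_nonneg)
    then show ?thesis
      using that by linarith
  qed
  consider "a \<le> 1/2" | "1/2 \<le> a" "a \<le> 72/100" | "72/100 \<le> a"
    by linarith
  then show ?thesis
  proof cases
    case 1
    \<comment> \<open>The step width \<open>sqrt pi * a\<close> absorbs the factor pi in the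
      exponent.\<close>
    have "sqrt pi * (a * (\<Sum>k=1..K. exp (- (pi * (real k * a)\<^sup>2))))
        = (\<Sum>k=1..K. (sqrt pi * a) * exp (- (real k * (sqrt pi * a))\<^sup>2))"
      by (simp add: sum_distrib_left power_mult_distrib mult_ac)
    also have "\<dots> \<le> sqrt pi * (1 / 2)"
      using gaussian_riemann_sum_le[of "sqrt pi * a" K] a by simp
    finally have "a * (\<Sum>k=1..K. exp (- (pi * (real k * a)\<^sup>2))) \<le> 1 / 2"
      by (rule mult_left_le_imp_le) simp
    then show ?thesis
      using 1 by (simp add: algebra_simps)
  next
    case 2
    \<comment> \<open>Here \<open>y\<close> equals \<open>3 * u\<^sup>2\<close>, and the cubic
      bound, about 0.476, is rounded up to 0.48. The final value is about 1.497, so the upper end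
      0.72 has little room to grow.\<close>
    then show ?thesis
      by (intro geometric[of "1/2" "72/100" "3/4" "48/100"]) (auto simp: power2_eq_square power3_eq_cube)
  next
    case 3
    \<comment> \<open>Here \<open>3 * u\<^sup>2\<close> is 1.5552, rounded down to 3/2; the cubic
      bound is about 0.239 and the final value about 1.487.\<close>
    then show ?thesis
      using a by (intro geometric[of "72/100" 1 "3/2" "24/100"]) (auto simp: power2_eq_square power3_eq_cube)
  qed
qed

text \<open>The range of \<open>j\<close> is that of a coefficient of a vector in the unit ball. For
  \<open>a > 1\<close> only \<open>j = 0\<close> remains and the product is 1.\<close>

lemma truncated_theta_factor_le:
  fixes a :: real
  assumes "a > 0"
  shows "min a 1 * (\<Sum>j\<in>{- \<lfloor>1 / a\<rfloor>..\<lfloor>1 / a\<rfloor>}. exp (- (pi * (of_int j * a)\<^sup>2))) \<le> 3 / 2"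
proof (cases "a \<le> 1")
  case True
  define N where "N = nat \<lfloor>1 / a\<rfloor>"
  have N: "\<lfloor>1 / a\<rfloor> = int N"
    using assms by (simp add: N_def)
  show ?thesis
    unfolding N using scaled_theta_sum_le[of a N] assms True
    by (subst sum_int_symmetric) auto
next
  case False
  then have "\<lfloor>1 / a\<rfloor> = 0"
    by (simp add: floor_eq_iff)
  then show ?thesis
    using False by simp
qed

text \<open>For \<open>x \<ge> 0\<close> the number \<open>2 * \<lfloor>x\<rfloor> + 1\<close> is at
  least 1 and at least \<open>x\<close>; one bound serves each value of the minimum.\<close>

lemma box_factor_ge:
  fixes a s :: real
  assumes "a > 0" "s \<ge> 1"
  shows "1 / s \<le> min a 1 * (2 * of_int \<lfloor>1 / (a * s)\<rfloor> + 1)"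
proof -
  let ?c = "2 * of_int \<lfloor>1 / (a * s)\<rfloor> + 1 :: real"
  have "0 \<le> \<lfloor>1 / (a * s)\<rfloor>"
    using assms by simp
  then have "1 \<le> ?c" "1 / (a * s) \<le> ?c"
    by linarith+
  moreover from this have "1 / s \<le> a * ?c"
    using assms by (simp add: field_simps)
  moreover have "1 / s \<le> 1"
    using assms by simp
  ultimately have "1 / s \<le> ?c" "1 / s \<le> a * ?c"
    by linarith+
  then show ?thesis
    by (simp add: min_def)
qed

section \<open>Integer combinations of orthogonal vectors\<close>

lemma int_span_finite:
  fixes B :: "'a::real_vector set"
  assumes "finite B"
  shows "int_mod.span B = range (\<lambda>k. \<Sum>b\<in>B. of_int (k b) *\<^sub>R b)"
  using int_mod.span_finite[OF assms] by (simp add: int_scale_def)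

lemma int_span_subset_span: "int_mod.span B \<subseteq> span B"
  by (intro int_mod.span_minimal)
    (auto simp: int_mod.subspace_def int_scale_def span_base span_zero span_add span_scale)

text \<open>Real independence comes from orthogonality of nonzero vectors, not from integer
  independence. The real basis that defines the lattice lies in the real span of \<open>B\<close>,
  so \<open>B\<close> spans the whole space.\<close>

lemma orthogonal_int_basis:
  fixes E :: "'a::euclidean_space set"
  assumes "euclidean_lattice E" "int_basis B E" "pairwise orthogonal B"
  shows "independent B" "finite B" "card B = DIM('a)"
proof -
  have "0 \<notin> B"
    using assms(2) int_mod.dependent_zero by (auto simp: int_basis_def)
  then show ind: "independent B"
    using assms(3) pairwise_orthogonal_independent by blast
  then show "finite B"
    by (rule independent_imp_finite)
  obtain C where C: "span C = UNIV" "E = int_mod.span C"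
    using assms(1) by (auto simp: euclidean_lattice_def)
  have "C \<subseteq> span B"
    using C(2) assms(2) int_mod.span_superset int_span_subset_span
    unfolding int_basis_def by blast
  then have "span B = UNIV"
    using C(1) span_mono[of C "span B"] by (auto simp: span_span)
  then show "card B = DIM('a)"
    using ind by (metis dim_UNIV dim_eq_card_independent dim_span)
qed

lemma norm_int_combination:
  fixes B :: "'a::euclidean_space set" and k :: "'a \<Rightarrow> int"
  assumes "finite B" "pairwise orthogonal B"
  shows "(norm (\<Sum>b\<in>B. of_int (k b) *\<^sub>R b))\<^sup>2 = (\<Sum>b\<in>B. (of_int (k b) * norm b)\<^sup>2)"
proof -
  have "pairwise (\<lambda>b c. orthogonal (of_int (k b) *\<^sub>R b) (of_int (k c) *\<^sub>R c)) B"
    using assms(2) by (auto simp: pairwise_def orthogonal_clauses)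
  then have "(norm (\<Sum>b\<in>B. of_int (k b) *\<^sub>R b))\<^sup>2 = (\<Sum>b\<in>B. (norm (of_int (k b) *\<^sub>R b))\<^sup>2)"
    by (rule norm_sum_Pythagorean[OF assms(1)])
  then show ?thesis
    by (simp add: power_mult_distrib)
qed

lemma int_coefficient_le:
  fixes B :: "'a::euclidean_space set" and k :: "'a \<Rightarrow> int"
  assumes "finite B" "pairwise orthogonal B" "b \<in> B"
  shows "\<bar>of_int (k b)\<bar> * norm b \<le> norm (\<Sum>b\<in>B. of_int (k b) *\<^sub>R b)"
proof (rule power2_le_imp_le)
  have "(of_int (k b) * norm b)\<^sup>2 \<le> (\<Sum>b\<in>B. (of_int (k b) * norm b)\<^sup>2)"
    using assms by (intro member_le_sum) auto
  then show "(\<bar>of_int (k b)\<bar> * norm b)\<^sup>2 \<le> (norm (\<Sum>b\<in>B. of_int (k b) *\<^sub>R b))\<^sup>2"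
    using assms by (simp add: norm_int_combination power_mult_distrib)
qed simp

section \<open>Successive minima of an orthogonal lattice\<close>

text \<open>A nonzero integer has absolute value at least 1, so a lattice vector of norm at most
  \<open>r\<close> has coefficient 0 at every basis vector longer than \<open>r\<close>.\<close>

lemma dim_int_span_cball:
  fixes B :: "'a::euclidean_space set"
  assumes "independent B" "pairwise orthogonal B"
  shows "dim (int_mod.span B \<inter> {m. norm m \<le> r}) = card {b \<in> B. norm b \<le> r}"
proof (rule dim_unique)
  have fin: "finite B"
    using assms(1) by (rule independent_imp_finite)
  show "{b \<in> B. norm b \<le> r} \<subseteq> int_mod.span B \<inter> {m. norm m \<le> r}"
    by (auto simp: int_mod.span_base)
  show "independent {b \<in> B. norm b \<le> r}"
    by (rule independent_mono[OF assms(1)]) auto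
  show "int_mod.span B \<inter> {m. norm m \<le> r} \<subseteq> span {b \<in> B. norm b \<le> r}"
  proof
    fix m assume "m \<in> int_mod.span B \<inter> {m. norm m \<le> r}"
    then obtain k where m: "m = (\<Sum>b\<in>B. of_int (k b) *\<^sub>R b)" "norm m \<le> r"
      using int_span_finite[OF fin] by auto
    have "of_int (k b) *\<^sub>R b \<in> span {b \<in> B. norm b \<le> r}" if "b \<in> B" for b
    proof (cases "k b = 0")
      case False
      have "1 * norm b \<le> \<bar>of_int (k b)\<bar> * norm b"
        using False by (intro mult_right_mono) (simp_all add: Ints_nonzero_abs_ge1)
      also have "\<dots> \<le> r"
        using int_coefficient_le[OF fin assms(2) that, of k] m by simp
      finally show ?thesis
        using that by (intro span_scale span_base) auto
    qed (simp add: span_zero)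
    then show "m \<in> span {b \<in> B. norm b \<le> r}"
      unfolding m(1) by (intro span_sum) auto
  qed
qed simp

text \<open>In a list sorted by norm the vectors of norm at most \<open>r\<close> form an initial
  segment. List positions start at 0 and successive minima at 1, hence \<open>Suc i\<close>.\<close>

lemma card_norm_le_iff:
  assumes "distinct bs" "sorted (map norm bs)" "i < length bs"
  shows "Suc i \<le> card {b \<in> set bs. norm b \<le> r} \<longleftrightarrow> norm (bs ! i) \<le> r"
proof
  assume le: "norm (bs ! i) \<le> r"
  have "set (take (Suc i) bs) \<subseteq> {b \<in> set bs. norm b \<le> r}"
  proof
    fix b assume "b \<in> set (take (Suc i) bs)"
    then obtain j where "j \<le> i" "b = bs ! j"
      using assms(3) by (auto simp: in_set_conv_nth less_Suc_eq_le)
    moreover from this have "norm (bs ! j) \<le> norm (bs ! i)"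
      using sorted_nth_mono[OF assms(2), of j i] assms(3) by simp
    ultimately show "b \<in> {b \<in> set bs. norm b \<le> r}"
      using le assms(3) by auto
  qed
  then have "card (set (take (Suc i) bs)) \<le> card {b \<in> set bs. norm b \<le> r}"
    by (intro card_mono) auto
  then show "Suc i \<le> card {b \<in> set bs. norm b \<le> r}"
    using assms by (simp add: distinct_card)
next
  assume le: "Suc i \<le> card {b \<in> set bs. norm b \<le> r}"
  show "norm (bs ! i) \<le> r"
  proof (rule ccontr)
    assume gt: "\<not> norm (bs ! i) \<le> r"
    have "{b \<in> set bs. norm b \<le> r} \<subseteq> set (take i bs)"
    proof
      fix b assume "b \<in> {b \<in> set bs. norm b \<le> r}"
      then obtain j where j: "j < length bs" "b = bs ! j" "norm (bs ! j) \<le> r"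
        by (auto simp: in_set_conv_nth)
      moreover from this have "j < i"
        using sorted_nth_mono[OF assms(2), of i j] gt by (cases "j < i") auto
      ultimately show "b \<in> set (take i bs)"
        by (auto simp: in_set_conv_nth)
    qed
    then have "card {b \<in> set bs. norm b \<le> r} \<le> card (set (take i bs))"
      by (intro card_mono) auto
    then show False
      using le card_length[of "take i bs"] by simp
  qed
qed

lemma successive_minimum_int_span:
  fixes bs :: "'a::euclidean_space list"
  assumes "independent (set bs)" "pairwise orthogonal (set bs)"
    and "distinct bs" "sorted (map norm bs)" "i < length bs"
  shows "successive_minimum (int_mod.span (set bs)) (Suc i) = norm (bs ! i)"
proof -
  \<comment> \<open>Positivity of this norm makes the admissible radii exactly a closed half-line,
    whose infimum is its endpoint.\<close>
  have "bs ! i \<noteq> 0"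
    using assms(1,5) dependent_zero nth_mem by metis
  then have "{r. r > 0 \<and> Suc i \<le> dim (span (int_mod.span (set bs) \<inter> {m. norm m \<le> r}))}
      = {norm (bs ! i)..}"
    using less_le_trans[of 0 "norm (bs ! i)"]
    by (auto simp: dim_int_span_cball[OF assms(1,2)] card_norm_le_iff[OF assms(3-5)])
  then show ?thesis
    by (simp add: successive_minimum_def)
qed

lemma sum_successive_minimum:
  fixes B :: "'a::euclidean_space set" and g :: "real \<Rightarrow> real"
  assumes "independent B" "pairwise orthogonal B"
  shows "(\<Sum>i=1..card B. g (successive_minimum (int_mod.span B) i)) = (\<Sum>b\<in>B. g (norm b))"
proof -
  obtain xs where xs: "set xs = B" "distinct xs"
    using assms(1) independent_imp_finite finite_distinct_list by blast
  define bs where "bs = sort_key norm xs"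
  have bs: "set bs = B" "distinct bs" "sorted (map norm bs)" "length bs = card B"
    using xs distinct_card[of xs] by (auto simp: bs_def)
  have "(\<Sum>i=1..card B. g (successive_minimum (int_mod.span B) i)) = (\<Sum>i<card B. g (norm (bs ! i)))"
    using successive_minimum_int_span[of bs] bs assms by (simp add: sum.atLeast1_atMost_eq)
  also have "\<dots> = (\<Sum>b\<in>B. g (norm b))"
    using bs sum.distinct_set_conv_list[of bs "\<lambda>b. g (norm b)"]
    by (simp add: sum_list_sum_nth atLeast0LessThan)
  finally show ?thesis .
qed

section \<open>Counting lattice points in the unit ball\<close>

lemma int_span_cball_subset:
  fixes B :: "'a::euclidean_space set"
  assumes "independent B" "pairwise orthogonal B"
  shows "{m \<in> int_mod.span B. norm m \<le> 1} \<subseteq> (\<lambda>k. \<Sum>b\<in>B. of_int (k b) *\<^sub>R b) `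
    {k \<in> \<Pi>\<^sub>E b\<in>B. {- \<lfloor>1 / norm b\<rfloor>..\<lfloor>1 / norm b\<rfloor>}. (\<Sum>b\<in>B. (of_int (k b) * norm b)\<^sup>2) \<le> 1}"
    (is "_ \<subseteq> ?\<Phi> ` ?K")
proof
  have fin: "finite B"
    using assms(1) by (rule independent_imp_finite)
  fix m assume "m \<in> {m \<in> int_mod.span B. norm m \<le> 1}"
  then obtain k where m: "m = ?\<Phi> k" "norm m \<le> 1"
    using int_span_finite[OF fin] by auto
  have "k b \<in> {- \<lfloor>1 / norm b\<rfloor>..\<lfloor>1 / norm b\<rfloor>}" if "b \<in> B" for b
  proof -
    have "b \<noteq> 0"
      using that assms(1) dependent_zero by blast
    moreover have "\<bar>of_int (k b)\<bar> * norm b \<le> 1"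
      using int_coefficient_le[OF fin assms(2) that, of k] m by simp
    ultimately have "of_int \<bar>k b\<bar> \<le> 1 / norm b"
      by (simp add: field_simps)
    then have "\<bar>k b\<bar> \<le> \<lfloor>1 / norm b\<rfloor>"
      by (simp only: le_floor_iff)
    then show ?thesis
      by auto
  qed
  moreover have "(\<Sum>b\<in>B. (of_int (k b) * norm b)\<^sup>2) \<le> 1"
    using m norm_int_combination[OF fin assms(2), of k] power_le_one[of "norm m" 2] by simp
  \<comment> \<open>Members of the product set are extensional; restricting \<open>k\<close>
    achieves this without changing sums over \<open>B\<close>.\<close>
  ultimately have "restrict k B \<in> ?K"
    by (auto cong: sum.cong)
  moreover have "m = ?\<Phi> (restrict k B)"
    using m by simp
  ultimately show "m \<in> ?\<Phi> ` ?K"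
    by blast
qed

text \<open>Finiteness is a separate conclusion because the lower bound and the positivity of the
  count rely on it.\<close>

lemma card_int_span_cball_le:
  fixes B :: "'a::euclidean_space set"
  assumes "independent B" "pairwise orthogonal B"
  shows "finite {m \<in> int_mod.span B. norm m \<le> 1}"
    and "real (card {m \<in> int_mod.span B. norm m \<le> 1}) \<le> exp pi *
      (\<Prod>b\<in>B. \<Sum>j\<in>{- \<lfloor>1 / norm b\<rfloor>..\<lfloor>1 / norm b\<rfloor>}. exp (- (pi * (of_int j * norm b)\<^sup>2)))"
proof -
  let ?S = "{m \<in> int_mod.span B. norm m \<le> 1}"
  let ?P = "\<Pi>\<^sub>E b\<in>B. {- \<lfloor>1 / norm b\<rfloor>..\<lfloor>1 / norm b\<rfloor>}"
  let ?Q = "\<lambda>k. \<Sum>b\<in>B. (of_int (k b) * norm b)\<^sup>2"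
  let ?K = "{k \<in> ?P. ?Q k \<le> 1}"
  have fin: "finite B"
    using assms(1) by (rule independent_imp_finite)
  have finP: "finite ?P"
    using fin by (intro finite_PiE) auto
  note sub = int_span_cball_subset[OF assms]
  show "finite ?S"
    using finP by (intro finite_subset[OF sub]) auto
  have "card ?S \<le> card ?K"
    using finP by (intro surj_card_le[OF _ sub]) auto
  then have "real (card ?S) \<le> (\<Sum>k\<in>?K. 1)"
    by simp
  also have "\<dots> \<le> (\<Sum>k\<in>?K. exp (pi * (1 - ?Q k)))"
    by (intro sum_mono) auto
  \<comment> \<open>Passing from the ellipsoid to the box adds only positive terms and makes the
    index set a product.\<close>
  also have "\<dots> \<le> (\<Sum>k\<in>?P. exp (pi * (1 - ?Q k)))"
    using finP by (intro sum_mono2) auto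
  also have "\<dots> = exp pi * (\<Sum>k\<in>?P. \<Prod>b\<in>B. exp (- (pi * (of_int (k b) * norm b)\<^sup>2)))"
    using fin by (simp add: sum_distrib_left right_diff_distrib exp_diff exp_minus divide_inverse
        exp_sum[symmetric] sum_negf flip: exp_minus)
  also have "\<dots> = exp pi *
      (\<Prod>b\<in>B. \<Sum>j\<in>{- \<lfloor>1 / norm b\<rfloor>..\<lfloor>1 / norm b\<rfloor>}. exp (- (pi * (of_int j * norm b)\<^sup>2)))"
    using fin by (subst prod_sum_PiE) auto
  finally show "real (card ?S) \<le> \<dots>" .
qed

text \<open>On the box each of the \<open>card B\<close> squares is at most
  \<open>1 / card B\<close>, so its points land in the unit ball; real independence keeps their
  images distinct.\<close>

lemma card_int_span_cball_ge:
  fixes B :: "'a::euclidean_space set"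
  assumes "independent B" "pairwise orthogonal B" "B \<noteq> {}"
  defines "s \<equiv> sqrt (card B)"
  shows "(\<Prod>b\<in>B. 2 * of_int \<lfloor>1 / (norm b * s)\<rfloor> + 1) \<le> real (card {m \<in> int_mod.span B. norm m \<le> 1})"
proof -
  let ?S = "{m \<in> int_mod.span B. norm m \<le> 1}"
  let ?P = "\<Pi>\<^sub>E b\<in>B. {- \<lfloor>1 / (norm b * s)\<rfloor>..\<lfloor>1 / (norm b * s)\<rfloor>}"
  let ?\<Phi> = "\<lambda>k. \<Sum>b\<in>B. of_int (k b) *\<^sub>R b"
  have fin: "finite B"
    using assms(1) by (rule independent_imp_finite)
  have s: "s > 0" "s\<^sup>2 = card B"
    using fin assms(3) by (auto simp: s_def card_gt_0_iff)
  have "inj_on ?\<Phi> ?P"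
  proof (rule inj_onI)
    fix k l assume k: "k \<in> ?P" and l: "l \<in> ?P" and "?\<Phi> k = ?\<Phi> l"
    then have "(\<Sum>b\<in>B. (of_int (k b) - of_int (l b)) *\<^sub>R b) = 0"
      by (simp add: scaleR_left_diff_distrib sum_subtractf)
    then have "of_int (k b) - of_int (l b) = (0::real)" if "b \<in> B" for b
      using that by (rule independentD[OF assms(1) fin subset_refl])
    then show "k = l"
      using k l by (intro PiE_ext) auto
  qed
  moreover have "?\<Phi> ` ?P \<subseteq> ?S"
  proof clarify
    fix k assume k: "k \<in> ?P"
    have "(of_int (k b) * norm b)\<^sup>2 \<le> 1 / card B" if "b \<in> B" for b
    proof -
      have "norm b > 0"
        using that assms(1) dependent_zero by auto
      have "\<bar>k b\<bar> \<le> \<lfloor>1 / (norm b * s)\<rfloor>"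
        using PiE_mem[OF k that] by auto
      then have "of_int \<bar>k b\<bar> \<le> 1 / (norm b * s)"
        by (simp only: le_floor_iff)
      then have "\<bar>of_int (k b) * norm b\<bar> \<le> 1 / s"
        using \<open>norm b > 0\<close> s by (simp add: abs_mult field_simps)
      then have "\<bar>of_int (k b) * norm b\<bar>\<^sup>2 \<le> (1 / s)\<^sup>2"
        by (intro power_mono) auto
      then show ?thesis
        using s by (simp add: power_divide)
    qed
    then have "(norm (?\<Phi> k))\<^sup>2 \<le> (\<Sum>b\<in>B. 1 / card B)"
      unfolding norm_int_combination[OF fin assms(2)] by (rule sum_mono)
    also have "\<dots> = 1\<^sup>2"
      using fin assms(3) by simp
    finally have "norm (?\<Phi> k) \<le> 1"
      by (rule power2_le_imp_le) simp
    then show "?\<Phi> k \<in> int_mod.span B \<and> norm (?\<Phi> k) \<le> 1"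
      using int_span_finite[OF fin] by auto
  qed
  ultimately have "card ?P \<le> card ?S"
    using card_int_span_cball_le(1)[OF assms(1,2)] by (intro card_inj_on_le)
  moreover have "real (card ?P) = (\<Prod>b\<in>B. 2 * of_int \<lfloor>1 / (norm b * s)\<rfloor> + 1)"
  proof -
    \<comment> \<open>The interval cardinality is a truncated \<open>nat\<close>; nonnegativity of
      the floor makes it the true odd number.\<close>
    have "0 \<le> \<lfloor>1 / (norm b * s)\<rfloor>" for b :: 'a
      using s by simp
    then have "real (nat (\<lfloor>1 / (norm b * s)\<rfloor> + 1 - - \<lfloor>1 / (norm b * s)\<rfloor>))
        = 2 * of_int \<lfloor>1 / (norm b * s)\<rfloor> + 1" for b :: 'a
      by (smt (verit) of_int_1 of_int_add of_nat_nat)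
    then show ?thesis
      using fin by (simp add: card_PiE)
  qed
  ultimately show ?thesis
    by linarith
qed

section \<open>The two inequalities for a lattice with an orthogonal basis\<close>

theorem theorem1p2:
  fixes E :: "'a::euclidean_space set" and n :: nat
  assumes "euclidean_lattice E"
    and "DIM('a) = n" and "n \<ge> 1"
    and "\<exists>B. int_basis B E \<and> pairwise orthogonal B"
  shows "- (1 / 2) * real n * ln (real n) + ln (1 - 1 / (2 * pi))
           \<le> h0_hat E + (\<Sum>i = 1..n. ln (min (successive_minimum E i) 1))
       \<and> h0_hat E + (\<Sum>i = 1..n. ln (min (successive_minimum E i) 1))
           \<le> pi + real n * ln (3 / 2)"
proof -
  obtain B where B: "int_basis B E" and orth: "pairwise orthogonal B"
    using assms(4) by blast
  have E: "E = int_mod.span B"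
    using B by (simp add: int_basis_def)
  note ind = orthogonal_int_basis(1)[OF assms(1) B orth]
    and fin = orthogonal_int_basis(2)[OF assms(1) B orth]
  have card: "card B = n"
    using orthogonal_int_basis(3)[OF assms(1) B orth] assms(2) by simp
  have pos: "norm b > 0" if "b \<in> B" for b
    using that ind dependent_zero by auto
  define N where "N = real (card {m \<in> E. norm m \<le> 1})"
  define M where "M = (\<Prod>b\<in>B. min (norm b) 1)"
  have M: "M > 0"
    unfolding M_def using pos by (intro prod_pos) auto
  \<comment> \<open>The origin makes the count positive, so its logarithm is a genuine one and adds
    to that of \<open>M\<close>.\<close>
  have "0 \<in> {m \<in> E. norm m \<le> 1}"
    using E int_mod.span_zero by auto
  then have N: "N > 0"
    using card_int_span_cball_le(1)[OF ind orth] E by (auto simp: N_def card_gt_0_iff)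
  have "(\<Sum>i = 1..n. ln (min (successive_minimum E i) 1)) = (\<Sum>b\<in>B. ln (min (norm b) 1))"
    using sum_successive_minimum[OF ind orth, of "\<lambda>x. ln (min x 1)"] E card by simp
  also have "\<dots> = ln M"
  proof -
    have "min (norm b) 1 \<noteq> 0" if "b \<in> B" for b
      using pos[OF that] by (simp add: min_def)
    then show ?thesis
      unfolding M_def using fin by (simp add: ln_prod)
  qed
  finally have total: "h0_hat E + (\<Sum>i = 1..n. ln (min (successive_minimum E i) 1)) = ln (M * N)"
    using M N by (simp add: h0_hat_def N_def ln_mult_pos)

  have "M * N \<le> M * (exp pi *
      (\<Prod>b\<in>B. \<Sum>j\<in>{- \<lfloor>1 / norm b\<rfloor>..\<lfloor>1 / norm b\<rfloor>}. exp (- (pi * (of_int j * norm b)\<^sup>2))))"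
    using M card_int_span_cball_le(2)[OF ind orth] by (simp add: N_def E)
  \<comment> \<open>Distributing \<open>M\<close> over the product pairs each minimum with the theta
    sum of the same basis vector.\<close>
  also have "\<dots> = exp pi * (\<Prod>b\<in>B. min (norm b) 1 *
      (\<Sum>j\<in>{- \<lfloor>1 / norm b\<rfloor>..\<lfloor>1 / norm b\<rfloor>}. exp (- (pi * (of_int j * norm b)\<^sup>2))))"
    by (simp add: M_def prod.distrib mult_ac)
  also have "\<dots> \<le> exp pi * (\<Prod>b\<in>B. 3 / 2)"
    using pos truncated_theta_factor_le
    by (intro mult_left_mono prod_mono conjI mult_nonneg_nonneg sum_nonneg) auto
  finally have "M * N \<le> exp pi * (3 / 2) ^ n"
    by (simp add: card)
  then have "ln (M * N) \<le> ln (exp pi * (3 / 2) ^ n)"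
    using M N by (subst ln_le_cancel_iff) auto
  then have upper: "ln (M * N) \<le> pi + real n * ln (3 / 2)"
    by (simp add: ln_mult_pos ln_realpow)

  let ?s = "sqrt (real n)"
  have s: "?s \<ge> 1"
    using assms(3) by simp
  have "(1 / ?s) ^ n = (\<Prod>b\<in>B. 1 / ?s)"
    by (simp add: card)
  also have "\<dots> \<le> (\<Prod>b\<in>B. min (norm b) 1 * (2 * of_int \<lfloor>1 / (norm b * ?s)\<rfloor> + 1))"
    using pos s box_factor_ge by (intro prod_mono) auto
  also have "\<dots> = M * (\<Prod>b\<in>B. 2 * of_int \<lfloor>1 / (norm b * ?s)\<rfloor> + 1)"
    by (simp add: M_def prod.distrib)
  also have "\<dots> \<le> M * N"
  proof -
    have "B \<noteq> {}"
      using card assms(3) by auto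
    then show ?thesis
      using M card_int_span_cball_ge[OF ind orth] by (simp add: N_def E card)
  qed
  finally have "ln ((1 / ?s) ^ n) \<le> ln (M * N)"
    using M N s by (subst ln_le_cancel_iff) auto
  moreover have "ln ((1 / ?s) ^ n) = - (1 / 2) * real n * ln (real n)"
    using assms(3) by (simp add: ln_realpow ln_div ln_sqrt)
  \<comment> \<open>The argument lies between 0 and 1, so the claimed lower bound follows from the
    box estimate.\<close>
  moreover have "ln (1 - 1 / (2 * pi)) \<le> 0"
    using pi_gt3 by (subst ln_le_zero_iff) (auto simp: field_simps)
  ultimately show ?thesis
    unfolding total using upper by linarith
qed

end
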